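(* If $F_t$ is a bounded one-parameter family on $\mathbb{R}^d$, then there is a ball $B$ such that $F_t(B)\subset B$ for all $t\in[0,t_0]$.
   Context: A function $f:\mathbb{R}^d\to\mathbb{R}^d$ is affine if $f(x)=Lx+a$, where $L$ is a non-singular $d\times d$ real matrix (the linear part of $f$) and $a\in\mathbb{R}^d$. A one-parameter affine family is given by $N\ge 2$ affine functions $F=\{f_1,\dots,f_N\}$ on $\mathbb{R}^d$ and vectors $q_1,\dots,q_N\in\mathbb{R}^d$; for each real $t\ge 0$ it is $F_t=\{f_{(i,t)} : 1\le i\le N\}$ with $f_{(i,t)}(x)=t f_i(x)+q_i$. It is a similarity family if each function is a similarity transformation. For a set $K$, $F_t(K)=\bigcup_{f\in F_t} f(K)$. If $L_1,\dots,L_N$ are the linear parts of $f_1,\dots,f_N$, the joint spectral radius of $F$ is $\rho(F)=\limsup_{k\to\infty}\big(\max\|L_{i_1}\cdots L_{i_k}\|\big)^{1/k}$, the maximum being over all words of length $k$ in $\{1,\dots,N\}$, and $t_0=1/\rho(F)$. Functions $f,g$ on $\mathbb{R}^d$ are conjugate by a function $h$ if $g=h^{-1}fh$. The family $F_t$ is semi-linear if, for all $i$ and all $t\in[0,t_0)$, $f_{(i,t)}$ is conjugate to a linear function by a function $h_i$ independent of $t$. A one-parameter similarity family $F_t$ is bounded if it is semi-linear and there is a unique function $\widehat f_t(x)=t\widehat f(x)+q_*\in F_t$ such that $\widehat f$ has maximum scaling ratio (among $f_1,\dots,f_N$). The symbol $\subset$ denotes inclusion, not necessarily proper. *)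

theory Defs
  imports "HOL-Analysis.Analysis"
begin

definition affine_map :: "(real^'d \<Rightarrow> real^'d) \<Rightarrow> bool" where
  "affine_map f \<longleftrightarrow> (\<exists>L a. invertible L \<and> f = (\<lambda>x. L *v x + a))"

definition linear_part :: "(real^'d \<Rightarrow> real^'d) \<Rightarrow> real^'d^'d" where
  "linear_part f = (THE L. \<exists>a. f = (\<lambda>x. L *v x + a))"

lemma linear_part_affine:
  fixes L :: "real^'d^'d"
  shows "linear_part (\<lambda>x. L *v x + a) = L"
  unfolding linear_part_def
proof (rule the_equality)
  fix M :: "real^'d^'d"
  assume "\<exists>b. (\<lambda>x. L *v x + a) = (\<lambda>x. M *v x + b)"
  then obtain b where eq: "L *v x + a = M *v x + b" for x
    by (auto dest: fun_cong)
  have "a = b"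
    using eq[of 0] by simp
  then show "M = L"
    using eq by (auto simp: matrix_eq)
qed blast

definition similarity_map :: "(real^'d \<Rightarrow> real^'d) \<Rightarrow> bool" where
  "similarity_map f \<longleftrightarrow> (\<exists>r>0. \<forall>x y. dist (f x) (f y) = r * dist x y)"

definition scaling_ratio :: "(real^'d \<Rightarrow> real^'d) \<Rightarrow> real" where
  "scaling_ratio f = (THE r. \<forall>x y. dist (f x) (f y) = r * dist x y)"

definition affine_family :: "nat \<Rightarrow> (nat \<Rightarrow> real^'d \<Rightarrow> real^'d) \<Rightarrow> (nat \<Rightarrow> real^'d) \<Rightarrow> bool" where
  "affine_family N f q \<longleftrightarrow> N \<ge> 2 \<and> (\<forall>i\<in>{1..N}. affine_map (f i))"

definition similarity_family :: "nat \<Rightarrow> (nat \<Rightarrow> real^'d \<Rightarrow> real^'d) \<Rightarrow> (nat \<Rightarrow> real^'d) \<Rightarrow> bool" where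
  "similarity_family N f q \<longleftrightarrow> affine_family N f q \<and> (\<forall>i\<in>{1..N}. similarity_map (f i))"

definition family_fun ::
  "(nat \<Rightarrow> real^'d \<Rightarrow> real^'d) \<Rightarrow> (nat \<Rightarrow> real^'d) \<Rightarrow> nat \<Rightarrow> real \<Rightarrow> real^'d \<Rightarrow> real^'d" where
  "family_fun f q i t = (\<lambda>x. t *\<^sub>R f i x + q i)"

definition family ::
  "nat \<Rightarrow> (nat \<Rightarrow> real^'d \<Rightarrow> real^'d) \<Rightarrow> (nat \<Rightarrow> real^'d) \<Rightarrow> real \<Rightarrow> (real^'d \<Rightarrow> real^'d) set" where
  "family N f q t = {family_fun f q i t | i. i \<in> {1..N}}"

definition family_image :: "(real^'d \<Rightarrow> real^'d) set \<Rightarrow> (real^'d) set \<Rightarrow> (real^'d) set" where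
  "family_image F K = (\<Union>g\<in>F. g ` K)"

definition word_matrix :: "(nat \<Rightarrow> real^'d \<Rightarrow> real^'d) \<Rightarrow> nat list \<Rightarrow> real^'d^'d" where
  "word_matrix f w = foldr (\<lambda>i M. linear_part (f i) ** M) w (mat 1)"

text \<open>
  The matrix norm is the Euclidean operator norm. The limit superior is taken in the extended
  reals, where it always exists; the term for \<open>k = 0\<close> (where \<open>root 0 x = 0\<close>) is irrelevant to it.
\<close>
definition joint_spectral_radius :: "nat \<Rightarrow> (nat \<Rightarrow> real^'d \<Rightarrow> real^'d) \<Rightarrow> ereal" where
  "joint_spectral_radius N f =
     limsup (\<lambda>k. ereal (root k
       (Max {onorm ((*v) (word_matrix f w)) | w. length w = k \<and> set w \<subseteq> {1..N}})))"

definition t0 :: "nat \<Rightarrow> (nat \<Rightarrow> real^'d \<Rightarrow> real^'d) \<Rightarrow> ereal" where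
  "t0 N f = 1 / joint_spectral_radius N f"

definition conjugate_by :: "('a \<Rightarrow> 'a) \<Rightarrow> ('a \<Rightarrow> 'a) \<Rightarrow> ('a \<Rightarrow> 'a) \<Rightarrow> bool" where
  "conjugate_by h f g \<longleftrightarrow> bij h \<and> g = inv h \<circ> f \<circ> h"

text \<open>
  The linear function may depend on \<open>t\<close> and may be singular: at \<open>t = 0\<close> every member of the
  family is constant, so it is necessarily zero there.
\<close>
definition semi_linear :: "nat \<Rightarrow> (nat \<Rightarrow> real^'d \<Rightarrow> real^'d) \<Rightarrow> (nat \<Rightarrow> real^'d) \<Rightarrow> bool" where
  "semi_linear N f q \<longleftrightarrow>
     (\<forall>i\<in>{1..N}. \<exists>h. \<forall>t::real. 0 \<le> t \<and> ereal t < t0 N f \<longrightarrow>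
        (\<exists>g. linear g \<and> conjugate_by h (family_fun f q i t) g))"

text \<open>
  Uniqueness is that of the function of \<open>t\<close> and \<open>x\<close>, not of its index, so that repetitions in the
  enumeration of the family are harmless.
\<close>
definition bounded_family :: "nat \<Rightarrow> (nat \<Rightarrow> real^'d \<Rightarrow> real^'d) \<Rightarrow> (nat \<Rightarrow> real^'d) \<Rightarrow> bool" where
  "bounded_family N f q \<longleftrightarrow>
     similarity_family N f q \<and> semi_linear N f q \<and>
     (\<exists>!g. \<exists>i\<in>{1..N}. g = family_fun f q i \<and>
        scaling_ratio (f i) = Max {scaling_ratio (f j) | j. j \<in> {1..N}})"

end

theory Submission
  imports Defs
begin

text \<open>
  Write \<open>r\<^sub>i\<close> for the scaling ratio of \<open>f\<^sub>i\<close> and \<open>R\<close> for the largest of them. A product of linear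
  parts multiplies every norm by the product of the corresponding ratios, so the joint spectral
  radius of a similarity family is \<open>R\<close> and \<open>t\<^sub>0 = 1/R\<close> (\<open>joint_spectral_radius_similarity_family\<close>).

  A linear map fixes \<open>0\<close>, so a function conjugated by \<open>h\<^sub>i\<close> to a linear one fixes \<open>h\<^sub>i 0\<close>. Hence
  semi-linearity gives the functions \<open>f\<^bsub>(i,t)\<^esub>\<close>, for varying \<open>t\<close>, a common fixed point. At \<open>t = 0\<close>
  the function is constant with value \<open>q\<^sub>i\<close>, so this point is \<open>q\<^sub>i\<close>, and any positive \<open>t < t\<^sub>0\<close> then
  shows that \<open>f\<^sub>i q\<^sub>i = 0\<close> (\<open>semi_linear_zero\<close>). Consequently \<open>f\<^bsub>(i,t)\<^esub>\<close> fixes \<open>q\<^sub>i\<close> and multiplies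
  distances by \<open>t r\<^sub>i \<le> 1\<close> for every \<open>t\<close> from \<open>0\<close> to \<open>t\<^sub>0\<close> inclusive.

  The ball is centred at the fixed point \<open>q\<^sub>*\<close> of the unique function with maximal ratio. That
  function maps every such ball into itself, because its ratio is at most \<open>1\<close>. Every other function
  contracts at least by the factor \<open>r\<^sub>i/R < 1\<close>, uniformly in \<open>t\<close>, and moves \<open>q\<^sub>*\<close> by at most twice its
  distance to \<open>q\<^sub>i\<close>; so it maps all sufficiently large balls around \<open>q\<^sub>*\<close> into themselves, and
  finitely many such conditions on the radius can be met together.
\<close>

section \<open>Scaling ratios of similarities\<close>

lemma scaling_ratio_eqI:
  fixes f :: "real^'d \<Rightarrow> real^'d"
  assumes "\<And>x y. dist (f x) (f y) = r * dist x y"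
  shows "scaling_ratio f = r"
  unfolding scaling_ratio_def
proof (rule the_equality)
  fix s
  assume s: "\<forall>x y. dist (f x) (f y) = s * dist x y"
  obtain b :: "real^'d" where "norm b = 1"
    using vector_choose_size zero_le_one by blast
  then show "s = r"
    using s assms[of b 0] by (metis dist_0_norm dist_commute mult.right_neutral)
qed (use assms in blast)

lemma
  fixes f :: "real^'d \<Rightarrow> real^'d"
  assumes "similarity_map f"
  shows scaling_ratio_pos: "scaling_ratio f > 0"
    and dist_similarity: "dist (f x) (f y) = scaling_ratio f * dist x y"
proof -
  obtain r where "r > 0" and r: "\<And>x y. dist (f x) (f y) = r * dist x y"
    using assms unfolding similarity_map_def by blast
  moreover have "scaling_ratio f = r"
    using r by (rule scaling_ratio_eqI)
  ultimately show "scaling_ratio f > 0"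
    and "dist (f x) (f y) = scaling_ratio f * dist x y"
    by auto
qed

lemma norm_linear_part_similarity:
  fixes f :: "real^'d \<Rightarrow> real^'d"
  assumes "affine_map f" "similarity_map f"
  shows "norm (linear_part f *v x) = scaling_ratio f * norm x"
proof -
  obtain L a where f: "f = (\<lambda>x. L *v x + a)"
    using assms(1) unfolding affine_map_def by blast
  have "norm (L *v x) = dist (f x) (f 0)"
    by (simp add: f dist_norm)
  then show ?thesis
    using dist_similarity[OF assms(2), of x 0] by (simp add: f linear_part_affine)
qed

section \<open>The joint spectral radius of a similarity family\<close>

lemma norm_word_matrix_similarity:
  fixes f :: "nat \<Rightarrow> real^'d \<Rightarrow> real^'d"
  assumes "\<And>i. i \<in> set w \<Longrightarrow> affine_map (f i) \<and> similarity_map (f i)"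
  shows "norm (word_matrix f w *v x) = prod_list (map (\<lambda>i. scaling_ratio (f i)) w) * norm x"
  using assms
proof (induction w arbitrary: x)
  case Nil
  then show ?case by (simp add: word_matrix_def)
next
  case (Cons i w)
  have "word_matrix f (i # w) *v x = linear_part (f i) *v (word_matrix f w *v x)"
    by (simp add: word_matrix_def matrix_vector_mul_assoc)
  then show ?case
    using Cons by (simp add: norm_linear_part_similarity)
qed

lemma onorm_eqI_scaling:
  fixes g :: "real^'d \<Rightarrow> real^'d"
  assumes "linear g" and g: "\<And>x. norm (g x) = c * norm x"
  shows "onorm g = c"
proof (rule antisym)
  show "onorm g \<le> c"
    using g by (intro onorm_le) simp
  obtain b :: "real^'d" where "norm b = 1"
    using vector_choose_size zero_le_one by blast
  then show "c \<le> onorm g"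
    using onorm[of g b] assms by (simp add: linear_conv_bounded_linear)
qed

lemma prod_list_le_power:
  fixes g :: "'a \<Rightarrow> real"
  assumes "\<And>i. i \<in> set w \<Longrightarrow> 0 \<le> g i \<and> g i \<le> R"
  shows "0 \<le> prod_list (map g w) \<and> prod_list (map g w) \<le> R ^ length w"
  using assms
proof (induction w)
  case (Cons i w)
  then have "0 \<le> g i" "g i \<le> R" "0 \<le> prod_list (map g w)" "prod_list (map g w) \<le> R ^ length w"
    by auto
  then show ?case
    by (simp add: mult_mono)
qed simp

text \<open>
  Among the words of length \<open>k\<close>, none beats the one that repeats the function of maximal ratio \<open>R\<close>,
  whose matrix has norm \<open>R ^ k\<close>. So the sequence of roots is constant from \<open>k = 1\<close> on.
\<close>

lemma joint_spectral_radius_similarity_family: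
  fixes f :: "nat \<Rightarrow> real^'d \<Rightarrow> real^'d"
  assumes fam: "similarity_family N f q"
    and m: "m \<in> {1..N}"
    and max: "\<And>i. i \<in> {1..N} \<Longrightarrow> scaling_ratio (f i) \<le> scaling_ratio (f m)"
  shows "joint_spectral_radius N f = ereal (scaling_ratio (f m))"
proof -
  define R where "R = scaling_ratio (f m)"
  have sim: "affine_map (f i) \<and> similarity_map (f i)" if "i \<in> {1..N}" for i
    using fam that unfolding similarity_family_def affine_family_def by blast
  have pos: "scaling_ratio (f i) > 0" if "i \<in> {1..N}" for i
    using sim[OF that] scaling_ratio_pos by blast
  have onorm_word: "onorm ((*v) (word_matrix f w)) = prod_list (map (\<lambda>i. scaling_ratio (f i)) w)"
    if "set w \<subseteq> {1..N}" for w
    by (rule onorm_eqI_scaling)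
      (use that sim in \<open>auto intro!: norm_word_matrix_similarity\<close>)
  have Max_eq: "Max {onorm ((*v) (word_matrix f w)) | w. length w = k \<and> set w \<subseteq> {1..N}} = R ^ k"
    (is "Max ?S = _") for k
  proof (rule Max_eqI)
    have "finite {w. set w \<subseteq> {1..N} \<and> length w = k}"
      by (rule finite_lists_length_eq) simp
    moreover have "?S = (\<lambda>w. onorm ((*v) (word_matrix f w))) ` {w. set w \<subseteq> {1..N} \<and> length w = k}"
      by blast
    ultimately show "finite ?S"
      by simp
    show "y \<le> R ^ k" if y: "y \<in> ?S" for y
    proof -
      obtain w where w: "y = onorm ((*v) (word_matrix f w))" "length w = k" "set w \<subseteq> {1..N}"
        using y by blast
      have "0 \<le> scaling_ratio (f i) \<and> scaling_ratio (f i) \<le> R" if "i \<in> set w" for i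
        using that w(3) pos[of i] max[of i] unfolding R_def by (auto simp: less_imp_le)
      then show ?thesis
        using prod_list_le_power[of w "\<lambda>i. scaling_ratio (f i)" R] w onorm_word by simp
    qed
    have word: "length (replicate k m) = k" "set (replicate k m) \<subseteq> {1..N}"
      using m by auto
    have "R ^ k = onorm ((*v) (word_matrix f (replicate k m)))"
      unfolding onorm_word[OF word(2)] by (simp add: R_def)
    then show "R ^ k \<in> ?S"
      using word by blast
  qed
  have "eventually (\<lambda>k. ereal (root k (R ^ k)) = ereal R) sequentially"
    using eventually_gt_at_top[of 0] by eventually_elim
      (use pos[OF m] in \<open>simp add: R_def real_root_power_cancel\<close>)
  then have "limsup (\<lambda>k. ereal (root k (R ^ k))) = limsup (\<lambda>k. ereal R)"
    by (rule Limsup_eq)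
  then show ?thesis
    unfolding joint_spectral_radius_def Max_eq by (simp add: Limsup_const R_def)
qed

section \<open>Semi-linear families and the invariant ball\<close>

text \<open>
  A single positive parameter below \<open>t\<^sub>0\<close> is enough to turn the common fixed point \<open>q\<^sub>i\<close> of the
  functions \<open>f\<^bsub>(i,t)\<^esub>\<close> into a zero of \<open>f\<^sub>i\<close>; after that the fixed point persists for all \<open>t\<close>.
\<close>

lemma semi_linear_zero:
  fixes f :: "nat \<Rightarrow> real^'d \<Rightarrow> real^'d"
  assumes "semi_linear N f q" and i: "i \<in> {1..N}" and "t0 N f > 0"
  shows "f i (q i) = 0"
proof -
  obtain h where h: "\<And>t. 0 \<le> t \<Longrightarrow> ereal t < t0 N f \<Longrightarrow>
      \<exists>g. linear g \<and> conjugate_by h (family_fun f q i t) g"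
    using assms(1) i unfolding semi_linear_def by blast
  have fixed: "t *\<^sub>R f i (h 0) + q i = h 0" if t: "0 \<le> t" "ereal t < t0 N f" for t
  proof -
    obtain g where "linear g" "bij h" and g: "g = inv h \<circ> family_fun f q i t \<circ> h"
      using h[OF t] unfolding conjugate_by_def by blast
    have "h (g 0) = family_fun f q i t (h 0)"
      using \<open>bij h\<close> by (simp add: g bij_is_surj surj_f_inv_f)
    moreover have "g 0 = 0"
      using \<open>linear g\<close> by (rule linear_0)
    ultimately show ?thesis
      by (simp add: family_fun_def)
  qed
  have "h 0 = q i"
    using fixed[of 0] assms(3) by (simp add: zero_ereal_def)
  moreover obtain t where "0 < ereal t" "ereal t < t0 N f"
    using ereal_dense2[OF assms(3)] by blast
  ultimately show ?thesis
    using fixed[of t] by simp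
qed

theorem theorem8p1:
  fixes N :: nat and f :: "nat \<Rightarrow> real^'d \<Rightarrow> real^'d" and q :: "nat \<Rightarrow> real^'d"
  assumes "bounded_family N f q"
  shows "\<exists>c r. r > 0 \<and>
    (\<forall>t::real. 0 \<le> t \<and> ereal t \<le> t0 N f \<longrightarrow>
       family_image (family N f q t) (cball c r) \<subseteq> cball c r)"
proof -
  define \<rho> where "\<rho> i = scaling_ratio (f i)" for i
  have fam: "similarity_family N f q" and semi: "semi_linear N f q"
    and unique: "\<exists>!g. \<exists>i\<in>{1..N}. g = family_fun f q i \<and> \<rho> i = Max {\<rho> j | j. j \<in> {1..N}}"
    using assms unfolding bounded_family_def \<rho>_def by auto
  obtain m where m: "m \<in> {1..N}" and \<rho>m: "\<rho> m = Max {\<rho> j | j. j \<in> {1..N}}"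
    using unique by blast
  have sim: "similarity_map (f i)" if "i \<in> {1..N}" for i
    using fam that unfolding similarity_family_def by blast
  have pos: "\<rho> i > 0" if "i \<in> {1..N}" for i
    unfolding \<rho>_def using sim[OF that] by (rule scaling_ratio_pos)
  have \<rho>_le: "\<rho> i \<le> \<rho> m" if "i \<in> {1..N}" for i
    unfolding \<rho>m by (rule Max_ge) (use that in auto)
  have t0: "t0 N f = ereal (1 / \<rho> m)"
    using joint_spectral_radius_similarity_family[OF fam m] \<rho>_le pos[OF m]
    unfolding t0_def \<rho>_def by (simp add: one_ereal_def)
  have zero: "f i (q i) = 0" if "i \<in> {1..N}" for i
    using semi_linear_zero[OF semi that] pos[OF m] by (simp add: t0 zero_ereal_def)

  have dist_image: "dist (family_fun f q i t x) (family_fun f q i t y) \<le> \<rho> i / \<rho> m * dist x y"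
    if "i \<in> {1..N}" "0 \<le> t" "ereal t \<le> t0 N f" for i t x y
  proof -
    have "dist (family_fun f q i t x) (family_fun f q i t y) = t * dist (f i x) (f i y)"
      using \<open>0 \<le> t\<close>
      by (simp add: family_fun_def dist_norm flip: scaleR_diff_right)
    also have "\<dots> = t * (\<rho> i * dist x y)"
      using dist_similarity[OF sim[OF that(1)]] by (simp add: \<rho>_def)
    also have "\<dots> \<le> 1 / \<rho> m * (\<rho> i * dist x y)"
      using that pos[of i] by (intro mult_right_mono) (auto simp: t0)
    finally show ?thesis
      by simp
  qed
  have fixed: "family_fun f q i t (q i) = q i" if "i \<in> {1..N}" for i t
    using zero[OF that] by (simp add: family_fun_def)

  \<comment> \<open>The bound \<open>2 * dist\<close> on the displacement of \<open>q m\<close>: each of \<open>q m\<close> and its image is within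
    \<open>dist (q i) (q m)\<close> of the fixed point \<open>q i\<close>.\<close>
  have "eventually (\<lambda>r. \<forall>i\<in>{1..N}. \<rho> i < \<rho> m \<longrightarrow> \<rho> i / \<rho> m * r + 2 * dist (q i) (q m) \<le> r) at_top"
  proof (intro eventually_ball_finite finite_atLeastAtMost ballI)
    fix i
    show "eventually (\<lambda>r. \<rho> i < \<rho> m \<longrightarrow> \<rho> i / \<rho> m * r + 2 * dist (q i) (q m) \<le> r) at_top"
      using eventually_ge_at_top[of "2 * dist (q i) (q m) / (1 - \<rho> i / \<rho> m)"]
    proof eventually_elim
      case (elim r)
      show ?case
      proof
        assume "\<rho> i < \<rho> m"
        then have "1 - \<rho> i / \<rho> m > 0"
          using pos[OF m] by simp
        then have "2 * dist (q i) (q m) \<le> r * (1 - \<rho> i / \<rho> m)"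
          using elim by (simp only: pos_divide_le_eq)
        then show "\<rho> i / \<rho> m * r + 2 * dist (q i) (q m) \<le> r"
          by (simp add: algebra_simps)
      qed
    qed
  qed
  then have "eventually (\<lambda>r. r > 0 \<and> (\<forall>i\<in>{1..N}. \<rho> i < \<rho> m \<longrightarrow>
      \<rho> i / \<rho> m * r + 2 * dist (q i) (q m) \<le> r)) at_top"
    using eventually_gt_at_top[of "0::real"] by eventually_elim blast
  then obtain r where "r > 0" and r: "\<And>i. i \<in> {1..N} \<Longrightarrow> \<rho> i < \<rho> m \<Longrightarrow>
      \<rho> i / \<rho> m * r + 2 * dist (q i) (q m) \<le> r"
    using eventually_happens'[OF trivial_limit_at_top_linorder] by blast

  have maps: "dist (q m) (family_fun f q i t x) \<le> r"
    if i: "i \<in> {1..N}" and t: "0 \<le> t" "ereal t \<le> t0 N f" and x: "dist (q m) x \<le> r" for i t x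
  proof (cases "\<rho> i < \<rho> m")
    case True
    have ratio: "0 \<le> \<rho> i / \<rho> m" "\<rho> i / \<rho> m \<le> 1"
      using pos[OF i] pos[OF m] \<rho>_le[OF i] by auto
    have "dist (family_fun f q i t (q m)) (family_fun f q i t x) \<le> \<rho> i / \<rho> m * dist (q m) x"
      using i t by (rule dist_image)
    also have "\<dots> \<le> \<rho> i / \<rho> m * r"
      using x ratio(1) by (rule mult_left_mono)
    finally have 1: "dist (family_fun f q i t (q m)) (family_fun f q i t x) \<le> \<rho> i / \<rho> m * r" .
    have "dist (q i) (family_fun f q i t (q m)) \<le> \<rho> i / \<rho> m * dist (q i) (q m)"
      using dist_image[OF i t, of "q i" "q m"] by (simp add: fixed[OF i])
    also have "\<dots> \<le> dist (q i) (q m)"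
      using mult_right_mono[OF ratio(2), of "dist (q i) (q m)"] by simp
    finally have "dist (q m) (family_fun f q i t (q m)) \<le> 2 * dist (q i) (q m)"
      using dist_triangle3[of "q m" "family_fun f q i t (q m)" "q i"] by simp
    then show ?thesis
      using 1 r[OF i True]
        dist_triangle[of "q m" "family_fun f q i t x" "family_fun f q i t (q m)"] by linarith
  next
    case False
    then have "\<rho> i = \<rho> m"
      using \<rho>_le[OF i] by simp
    \<comment> \<open>Indices may repeat, so uniqueness identifies the functions rather than \<open>i\<close> and \<open>m\<close>.\<close>
    then have "family_fun f q i = family_fun f q m"
      using unique i m \<rho>m by metis
    then have "dist (q m) (family_fun f q i t x) \<le> dist (q m) x"
      using dist_image[OF m t, of "q m" x] pos[OF m] by (simp add: fixed[OF m])
    then show ?thesis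
      using x by linarith
  qed
  show ?thesis
  proof (intro exI conjI allI impI)
    fix t :: real
    assume "0 \<le> t \<and> ereal t \<le> t0 N f"
    then show "family_image (family N f q t) (cball (q m) r) \<subseteq> cball (q m) r"
      using maps by (auto simp: family_image_def family_def)
  qed (fact \<open>r > 0\<close>)
qed

end
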